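(* Let $a,b,c,d,e$ be nonzero integers, and let $f(x)=x+a+\frac{b}{x}$ and $g(y)=y+c+\frac{d}{y}+\frac{e}{y^2}$. Then the Diophantine equation $z^2=f(x)^2+g(y)^2$ or the Diophantine equation $z^2=f(x)^2-g(y)^2$ has infinitely many nontrivial rational parametric solutions $(x,y,z)$.
   Context: A solution $(x,y,z)$ of $z^2=f(x)^2\pm g(y)^2$ is called nontrivial if $f(x)g(y)\neq 0$ and $f(x)^2\neq g(y)^2$. A rational parametric solution is a solution $(x,y,z)$ whose coordinates are rational functions (with rational coefficients) of a parameter, i.e. a solution over the field $\mathbb{Q}(T)$ of rational functions in an indeterminate $T$. *)

theory Defs
  imports "HOL-Computational_Algebra.Fraction_Field" "HOL-Computational_Algebra.Polynomial"
begin

text \<open>The field of rational functions with rational coefficients in one indeterminate.\<close>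

type_synonym ratfun = "rat poly fract"

definition f_fun :: "int \<Rightarrow> int \<Rightarrow> ratfun \<Rightarrow> ratfun" where
  "f_fun a b x = x + of_int a + of_int b / x"

definition g_fun :: "int \<Rightarrow> int \<Rightarrow> int \<Rightarrow> ratfun \<Rightarrow> ratfun" where
  "g_fun c d e y = y + of_int c + of_int d / y + of_int e / y ^ 2"

text \<open>
  Since division by zero is total in HOL, the conditions \<open>x \<noteq> 0\<close> and \<open>y \<noteq> 0\<close>, which say that
  \<open>f(x)\<close> and \<open>g(y)\<close> are defined, are part of being a solution.
  Constant rational functions are elements of the field and hence admitted as coordinates.
\<close>

definition sum_solution :: "int \<Rightarrow> int \<Rightarrow> int \<Rightarrow> int \<Rightarrow> int \<Rightarrow> ratfun \<times> ratfun \<times> ratfun \<Rightarrow> bool" where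
  "sum_solution a b c d e = (\<lambda>(x, y, z).
     x \<noteq> 0 \<and> y \<noteq> 0 \<and> z ^ 2 = f_fun a b x ^ 2 + g_fun c d e y ^ 2)"

definition diff_solution :: "int \<Rightarrow> int \<Rightarrow> int \<Rightarrow> int \<Rightarrow> int \<Rightarrow> ratfun \<times> ratfun \<times> ratfun \<Rightarrow> bool" where
  "diff_solution a b c d e = (\<lambda>(x, y, z).
     x \<noteq> 0 \<and> y \<noteq> 0 \<and> z ^ 2 = f_fun a b x ^ 2 - g_fun c d e y ^ 2)"

definition nontrivial :: "int \<Rightarrow> int \<Rightarrow> int \<Rightarrow> int \<Rightarrow> int \<Rightarrow> ratfun \<times> ratfun \<times> ratfun \<Rightarrow> bool" where
  "nontrivial a b c d e = (\<lambda>(x, y, z).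
     f_fun a b x * g_fun c d e y \<noteq> 0 \<and> f_fun a b x ^ 2 \<noteq> g_fun c d e y ^ 2)"

end

theory Submission
  imports Defs
begin

text \<open>
  Fix \<open>y\<close> and put \<open>G = g(y)\<close>. Multiplying \<open>z\<^sup>2 = f(x)\<^sup>2 + G\<^sup>2\<close> by \<open>x\<^sup>2\<close> gives the quartic curve
  \<open>w\<^sup>2 = (x\<^sup>2 + a x + b)\<^sup>2 + G\<^sup>2 x\<^sup>2\<close>. The parabola \<open>w = x\<^sup>2 + a x + b + G\<^sup>2/2\<close> agrees with it up to
  the term in \<open>x\<^sup>2\<close> at infinity, so it meets the curve in only one finite point, namely
  \<open>x = -(4 b + G\<^sup>2) / (4 a)\<close>. This point is a nontrivial solution unless \<open>G\<close> is a root of one of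
  finitely many nonzero polynomials, that is, for all but finitely many \<open>y\<close>.
\<close>

lemma infinite_UNIV_fract: "infinite (UNIV :: 'a::{idom, ring_char_0} fract set)"
proof
  assume fin: "finite (UNIV :: 'a fract set)"
  have "inj (\<lambda>n. Fraction_Field.Fract (of_nat n :: 'a) 1)"
    by (rule injI) (simp add: eq_fract)
  then have "finite (UNIV :: nat set)"
    using fin finite_subset[OF subset_UNIV] by (auto dest: finite_imageD)
  then show False by simp
qed

text \<open>Carries \<open>a \<noteq> 0\<close> and the nonvanishing of the numerals 2 and 4 over to
  the function field, where the proof divides by them.\<close>

lemma of_int_fract_eq_0_iff: "(of_int n :: 'a::{idom, ring_char_0} fract) = 0 \<longleftrightarrow> n = 0"
proof -
  have nat: "(of_nat m :: 'a fract) = Fraction_Field.Fract (of_nat m) 1" for m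
    by (induction m) (simp_all add: Zero_fract_def One_fract_def)
  have "(of_int n :: 'a fract) = Fraction_Field.Fract (of_int n) 1"
    by (cases n rule: int_cases2) (simp_all add: nat)
  then show ?thesis
    by (simp add: Zero_fract_def eq_fract)
qed

text \<open>Clearing the denominator \<open>y^2\<close> in g(y) = r leaves a monic cubic in y, so
  each value r is taken at most three times.\<close>

lemma finite_g_fun_vimage:
  assumes "finite S"
  shows "finite {y. y \<noteq> 0 \<and> g_fun c d e y \<in> S}"
proof -
  let ?p = "\<lambda>r. [:of_int e, of_int d, of_int c - r, 1:] :: ratfun poly"
  have "poly (?p (g_fun c d e y)) y = 0" if "y \<noteq> 0" for y
    using that by (simp add: g_fun_def field_simps power2_eq_square)
  then have "{y. y \<noteq> 0 \<and> g_fun c d e y \<in> S} \<subseteq> (\<Union>r\<in>S. {y. poly (?p r) y = 0})"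
    by blast
  moreover have "finite (\<Union>r\<in>S. {y. poly (?p r) y = 0})"
    using assms by (intro finite_UN_I poly_roots_finite) simp_all
  ultimately show ?thesis
    by (rule finite_subset)
qed

text \<open>With \<open>h = G^2 / 2\<close> the two sides differ by
  \<open>h * (2 * A * x + 2 * B + h)\<close>, and the linear hypothesis makes the second factor
  vanish.\<close>

lemma tangent_parabola_point:
  fixes A B G x :: "'a::field"
  assumes "4 * A * x = - (4 * B + G\<^sup>2)" "2 \<noteq> (0::'a)"
  shows "(x\<^sup>2 + A * x + B + G\<^sup>2 / 2)\<^sup>2 = (x\<^sup>2 + A * x + B)\<^sup>2 + (G * x)\<^sup>2"
proof -
  define h where "h = G\<^sup>2 / 2"
  have G: "G\<^sup>2 = 2 * h"
    using assms(2) by (simp add: h_def)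
  have "2 * (2 * A * x + 2 * B + h) = 0"
    using assms(1) by (simp add: G algebra_simps)
  then have "2 * A * x + 2 * B + h = 0"
    using assms(2) by (metis mult_eq_0_iff)
  then have "h * (2 * A * x + 2 * B + h) = 0"
    by simp
  then show ?thesis
    unfolding h_def[symmetric] power_mult_distrib G
    by (simp add: power2_eq_square algebra_simps)
qed

theorem theorem1p2:
  fixes a b c d e :: int
  assumes "a \<noteq> 0" and "b \<noteq> 0" and "c \<noteq> 0" and "d \<noteq> 0" and "e \<noteq> 0"
  shows "infinite {s. sum_solution a b c d e s \<and> nontrivial a b c d e s} \<or>
         infinite {s. diff_solution a b c d e s \<and> nontrivial a b c d e s}"
proof -
  define A B where "A = (of_int a :: ratfun)" and "B = (of_int b :: ratfun)"
  define g where "g = g_fun c d e"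
  define X where "X y = - (4 * B + (g y)\<^sup>2) / (4 * A)" for y
  \<comment> \<open>This is the ordinate w of the point on the quartic; the solution takes z =
    w/x.\<close>
  define Z where "Z y = (X y)\<^sup>2 + A * X y + B + (g y)\<^sup>2 / 2" for y
  have A: "A \<noteq> 0"
    using assms(1) by (simp add: A_def of_int_fract_eq_0_iff)
  have two: "(2::ratfun) \<noteq> 0" and four: "(4::ratfun) \<noteq> 0"
    using of_int_fract_eq_0_iff[of 2, where 'a = "rat poly"]
      of_int_fract_eq_0_iff[of 4, where 'a = "rat poly"] by simp_all
  \<comment> \<open>The members of \<open>P\<close> are, up to constants, the numerators of \<open>G\<close>, \<open>x\<close>, \<open>f(x)\<close> and \<open>f(x) \<plusminus> G\<close>.\<close>
  define P :: "ratfun poly set" where "P = {[:0, 1:], [:4 * B, 0, 1:],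
    [:16 * B\<^sup>2, 0, 8 * B - 4 * A\<^sup>2, 0, 1:],
    [:16 * B\<^sup>2, 16 * A * B, 8 * B - 4 * A\<^sup>2, 4 * A, 1:],
    [:16 * B\<^sup>2, - 16 * A * B, 8 * B - 4 * A\<^sup>2, - 4 * A, 1:]}"
  define Y where "Y = {y. y \<noteq> 0 \<and> g y \<notin> (\<Union>p\<in>P. {r. poly p r = 0})}"
  have solution: "sum_solution a b c d e (X y, y, Z y / X y) \<and>
      nontrivial a b c d e (X y, y, Z y / X y)" if "y \<in> Y" for y
  proof -
    define G x where "G = g y" and "x = X y"
    have y: "y \<noteq> 0" and P: "\<forall>p\<in>P. poly p G \<noteq> 0"
      using that by (simp_all add: Y_def G_def)
    have x: "4 * A * x = - (4 * B + G\<^sup>2)"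
      using A four by (simp add: x_def X_def G_def)
    have "4 * B + G\<^sup>2 \<noteq> 0"
      using P by (auto simp: P_def power2_eq_square)
    then have "4 * A * x \<noteq> 0"
      unfolding x by (metis neg_equal_0_iff_equal)
    then have x0: "x \<noteq> 0" by auto
    have f: "f_fun a b x = (x\<^sup>2 + A * x + B) / x"
      using x0 by (simp add: f_fun_def A_def B_def field_simps power2_eq_square)
    \<comment> \<open>The factor \<open>16 * A^2\<close> makes x occur only through
      \<open>4 * A * x\<close>, which is a polynomial in G. The values k = 0, 1, -1 give the
      numerators of f(x), f(x) + G and f(x) - G.\<close>
    have scaled: "16 * A\<^sup>2 * (x\<^sup>2 + A * x + B + k * G * x) =
        poly [:16 * B\<^sup>2, - 16 * k * A * B, 8 * B - 4 * A\<^sup>2, - 4 * k * A, 1:] G" for k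
    proof -
      have "16 * A\<^sup>2 * (x\<^sup>2 + A * x + B + k * G * x) =
          (4 * A * x)\<^sup>2 + 4 * A\<^sup>2 * (4 * A * x) + 16 * A\<^sup>2 * B + 4 * k * A * G * (4 * A * x)"
        by algebra
      also have "\<dots> = poly [:16 * B\<^sup>2, - 16 * k * A * B, 8 * B - 4 * A\<^sup>2, - 4 * k * A, 1:] G"
        unfolding x by (simp add: power2_eq_square algebra_simps)
      finally show ?thesis .
    qed
    have nz: "x\<^sup>2 + A * x + B + k * G * x \<noteq> 0" if "k \<in> {0, 1, -1}" for k
    proof -
      have "[:16 * B\<^sup>2, - 16 * k * A * B, 8 * B - 4 * A\<^sup>2, - 4 * k * A, 1:] \<in> P"
        using that by (auto simp: P_def)
      then have "16 * A\<^sup>2 * (x\<^sup>2 + A * x + B + k * G * x) \<noteq> 0"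
        unfolding scaled using P by blast
      then show ?thesis by auto
    qed
    have "f_fun a b x \<noteq> 0" "f_fun a b x - G \<noteq> 0" "f_fun a b x + G \<noteq> 0"
      using nz[of 0] nz[of 1] nz[of "-1"] x0 by (simp_all add: f field_simps)
    moreover have "G \<noteq> 0"
      using P by (auto simp: P_def)
    moreover have "(f_fun a b x)\<^sup>2 - G\<^sup>2 = (f_fun a b x + G) * (f_fun a b x - G)"
      by (simp add: power2_eq_square algebra_simps)
    ultimately have "f_fun a b x * G \<noteq> 0 \<and> (f_fun a b x)\<^sup>2 - G\<^sup>2 \<noteq> 0"
      by (simp only: mult_eq_0_iff) simp
    then have "nontrivial a b c d e (x, y, Z y / x)"
      unfolding nontrivial_def G_def g_def prod.case right_minus_eq .
    moreover have "(Z y)\<^sup>2 = (x\<^sup>2 + A * x + B)\<^sup>2 + G\<^sup>2 * x\<^sup>2"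
      using tangent_parabola_point[OF x two]
      by (simp only: Z_def x_def[symmetric] G_def[symmetric] power_mult_distrib)
    then have "(Z y / x)\<^sup>2 = (f_fun a b x)\<^sup>2 + G\<^sup>2"
      unfolding f power_divide using x0 by (metis add_divide_distrib nonzero_mult_div_cancel_right power_not_zero)
    ultimately show ?thesis
      using x0 y by (simp add: sum_solution_def G_def g_def x_def)
  qed
  \<comment> \<open>Every member of \<open>P\<close> is monic, hence nonzero whatever A and B are,
    so only finitely many values of G are excluded.\<close>
  have "finite {y. y \<noteq> 0 \<and> g y \<in> (\<Union>p\<in>P. {r. poly p r = 0})}"
    unfolding g_def
    by (intro finite_g_fun_vimage finite_UN_I poly_roots_finite) (auto simp: P_def)
  moreover have "UNIV - Y = insert 0 {y. y \<noteq> 0 \<and> g y \<in> (\<Union>p\<in>P. {r. poly p r = 0})}"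
    by (auto simp: Y_def)
  ultimately have "finite (UNIV - Y)"
    by simp
  then have "infinite Y"
    using infinite_UNIV_fract finite_Diff2 by blast
  moreover have "inj_on (\<lambda>y. (X y, y, Z y / X y)) Y"
    by (rule inj_onI) simp
  ultimately have "infinite ((\<lambda>y. (X y, y, Z y / X y)) ` Y)"
    by (simp add: finite_image_iff)
  moreover have "(\<lambda>y. (X y, y, Z y / X y)) ` Y \<subseteq>
      {s. sum_solution a b c d e s \<and> nontrivial a b c d e s}"
    using solution by auto
  ultimately show ?thesis
    using infinite_super by blast
qed

end
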